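(* Let ${\bf f}=(f_1,\ldots,f_n)$ be given by $n$ linear polynomials $f_1,\ldots,f_n$ in $d$ unknowns $\theta_1,\ldots,\theta_d$ with real coefficients. Then the ML degree of ${\bf f}$ is equal to the number of bounded regions of $V_{\mathbb{R}}=\mathbb{R}^d\setminus\bigcup_{i=1}^n\{f_i=0\}$, and all critical points of the optimization problem of maximizing $f_1(\theta)^{u_1}f_2(\theta)^{u_2}\cdots f_n(\theta)^{u_n}$ are real.
   Context: The linear polynomials $f_i=\sum_{j=1}^d a_{ij}\theta_j+c_i$ may be inhomogeneous and are not assumed to be generic; no hypothesis such as global normal crossing is made. The exponents $u_1,\ldots,u_n$ are positive integers (the data vector $u$). A bounded region of $V_{\mathbb{R}}$ is a connected component that is bounded as a subset of $\mathbb{R}^d$. The critical points of the optimization problem are the complex solutions $\theta\in\mathbb{C}^d$ (with all $f_i(\theta)\neq 0$) of the critical equations $\sum_{i=1}^n u_ia_{ij}/f_i(\theta)=0$ for $j=1,\ldots,d$. The ML degree (maximum likelihood degree) of ${\bf f}$ is the number of complex solutions to these critical equations, counted with multiplicities, for a general data vector $u$.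
   Formalization: Added assumption: the linear parts of the f_i span R^d, or the critical set is finite for general u. Without it the claim fails: for f_1=θ_1, f_2=1-θ_1 in d=2 unknowns and u=(1,1) the critical set is {1/2}×C, while there are no bounded regions. *)

theory Defs
  imports "HOL-Analysis.Analysis" "HOL-Library.Extended_Nat"
begin

text \<open>
  The arrangement is given by the matrix of linear coefficients and the vector of constant terms.
  The scalar type is left open so that the same polynomials can be evaluated at real and at complex
  points.
\<close>

definition lin_poly ::
    "real^'d^'n \<Rightarrow> real^'n \<Rightarrow> 'n \<Rightarrow> 'k::real_field^'d \<Rightarrow> 'k" where
  "lin_poly a c i \<theta> = (\<Sum>j\<in>UNIV. of_real (a $ i $ j) * \<theta> $ j) + of_real (c $ i)"

definition real_complement :: "real^'d^'n \<Rightarrow> real^'n \<Rightarrow> (real^'d) set" where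
  "real_complement a c = UNIV - (\<Union>i. {\<theta>. lin_poly a c i \<theta> = 0})"

definition bounded_regions :: "real^'d^'n \<Rightarrow> real^'n \<Rightarrow> (real^'d) set set" where
  "bounded_regions a c = {R \<in> components (real_complement a c). bounded R}"

definition critical_eq ::
    "real^'d^'n \<Rightarrow> real^'n \<Rightarrow> nat^'n \<Rightarrow> 'd \<Rightarrow> complex^'d \<Rightarrow> complex" where
  "critical_eq a c u j \<theta> =
     (\<Sum>i\<in>UNIV. of_nat (u $ i) * of_real (a $ i $ j) / lin_poly a c i \<theta>)"

definition critical_points ::
    "real^'d^'n \<Rightarrow> real^'n \<Rightarrow> nat^'n \<Rightarrow> (complex^'d) set" where
  "critical_points a c u =
     {\<theta>. (\<forall>i. lin_poly a c i \<theta> \<noteq> 0) \<and> (\<forall>j. critical_eq a c u j \<theta> = 0)}"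

text \<open>
  The multiplicity of a solution \<open>p\<close> of a system \<open>g\<close> is the complex dimension of the local
  ring at \<open>p\<close> modulo the ideal generated by \<open>g\<close>.  The library notion
  \<^const>\<open>polynomial_function\<close> means polynomial over the reals (so that it admits complex
  conjugation), hence the separate definition of complex polynomial functions.
\<close>

inductive complex_polynomial_function :: "(complex^'d \<Rightarrow> complex) \<Rightarrow> bool" where
  const: "complex_polynomial_function (\<lambda>x. k)"
| coord: "complex_polynomial_function (\<lambda>x. x $ j)"
| add: "complex_polynomial_function P \<Longrightarrow> complex_polynomial_function Q \<Longrightarrow>
          complex_polynomial_function (\<lambda>x. P x + Q x)"
| mult: "complex_polynomial_function P \<Longrightarrow> complex_polynomial_function Q \<Longrightarrow>
          complex_polynomial_function (\<lambda>x. P x * Q x)"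

text \<open>
  Elements of the local ring are represented by total functions that agree near \<open>p\<close> with a
  rational function regular at \<open>p\<close>.  Two rational functions agreeing near \<open>p\<close> are equal.
  Functions vanishing near \<open>p\<close> belong to \<open>local_ideal g p\<close>, so the quotient of
  \<open>local_ring p\<close> by \<open>local_ideal g p\<close> is the usual local algebra.
\<close>

definition local_ring :: "complex^'d \<Rightarrow> (complex^'d \<Rightarrow> complex) set" where
  "local_ring p =
     {h. \<exists>P Q. complex_polynomial_function P \<and> complex_polynomial_function Q \<and> Q p \<noteq> 0 \<and>
               (\<forall>\<^sub>F x in nhds p. h x = P x / Q x)}"

definition local_ideal ::
    "('m::finite \<Rightarrow> complex^'d \<Rightarrow> complex) \<Rightarrow> complex^'d \<Rightarrow> (complex^'d \<Rightarrow> complex) set" where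
  "local_ideal g p =
     {h \<in> local_ring p. \<exists>r. (\<forall>j. r j \<in> local_ring p) \<and>
               (\<forall>\<^sub>F x in nhds p. h x = (\<Sum>j\<in>UNIV. r j x * g j x))}"

text \<open>
  The dimension of the quotient is the supremum of the sizes of the finite sets that are linearly
  independent modulo the ideal.
\<close>

definition solution_multiplicity ::
    "('m::finite \<Rightarrow> complex^'d \<Rightarrow> complex) \<Rightarrow> complex^'d \<Rightarrow> enat" where
  "solution_multiplicity g p =
     (SUP B \<in> {B. finite B \<and> B \<subseteq> local_ring p \<and>
                  (\<forall>k. (\<lambda>x. \<Sum>b\<in>B. k b * b x) \<in> local_ideal g p \<longrightarrow> (\<forall>b\<in>B. k b = 0))}.
        enat (card B))"

definition data_vector :: "nat^'n \<Rightarrow> bool" where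
  "data_vector u \<longleftrightarrow> (\<forall>i. 0 < u $ i)"

text \<open>
  A property holds for a general data vector if it holds for all data vectors outside the zero set
  of some nonzero polynomial.  Nonempty Zariski open sets intersect and contain data vectors, so
  at most one number \<open>m\<close> satisfies \<open>has_ML_degree a c m\<close>.
\<close>

definition for_general_data :: "(nat^'n \<Rightarrow> bool) \<Rightarrow> bool" where
  "for_general_data P \<longleftrightarrow>
     (\<exists>h :: real^'n \<Rightarrow> real. real_polynomial_function h \<and> (\<exists>x. h x \<noteq> 0) \<and>
        (\<forall>u. data_vector u \<and> h (\<chi> i. of_nat (u $ i)) \<noteq> 0 \<longrightarrow> P u))"

definition has_ML_degree :: "real^'d^'n \<Rightarrow> real^'n \<Rightarrow> nat \<Rightarrow> bool" where
  "has_ML_degree a c m \<longleftrightarrow>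
     for_general_data (\<lambda>u. finite (critical_points a c u) \<and>
       (\<Sum>p\<in>critical_points a c u. solution_multiplicity (critical_eq a c u) p) = enat m)"

end

theory Submission
  imports Defs
begin

text \<open>
  The critical points of \<open>\<Prod>\<^sub>i f\<^sub>i ^ u\<^sub>i\<close> are matched one by one with the bounded regions, for every data
  vector \<open>u\<close> and not only for a general one, and each of them counts once.

  Write \<open>f\<^sub>i(\<theta>) = a\<^sub>i \<cdot> \<theta> + c\<^sub>i\<close>. A critical point satisfies \<open>\<Sum>\<^sub>i u\<^sub>i (a\<^sub>i \<cdot> v) / f\<^sub>i(\<theta>) = 0\<close> for every
  direction \<open>v\<close>. When \<open>a\<close> is injective, this identity gives the theorem in four steps.

  \<^item> Reality (\<open>critical_point_Im\<close>): for \<open>v = Im \<theta>\<close> the imaginary part of the identity is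
    \<open>- \<Sum>\<^sub>i u\<^sub>i (a\<^sub>i \<cdot> v)\<^sup>2 / \<bar>f\<^sub>i(\<theta>)\<bar>\<^sup>2\<close>, so \<open>a v = 0\<close>.
  \<^item> Boundedness (\<open>chamber_of_critical_point_bounded\<close>): for a real critical point \<open>x\<close>,
    \<open>v = y - x\<close> gives \<open>\<Sum>\<^sub>i u\<^sub>i f\<^sub>i(y) / f\<^sub>i(x) = \<Sum>\<^sub>i u\<^sub>i\<close>. On the region of \<open>x\<close> all terms are positive,
    which bounds every \<open>f\<^sub>i\<close> there.
  \<^item> Existence and uniqueness (\<open>critical_point_exists\<close>, \<open>critical_point_unique\<close>): on a
    region where the \<open>f\<^sub>i\<close> are bounded, \<open>\<Sum>\<^sub>i u\<^sub>i ln \<bar>f\<^sub>i\<bar>\<close> tends to minus infinity at the walls, hence has a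
    maximum, and it is concave, strictly so modulo the kernel of \<open>a\<close>.
  \<^item> Multiplicity one (\<open>critical_point_multiplicity\<close>): the Jacobian of the critical equations at a
    real point is \<open>- \<Sum>\<^sub>i u\<^sub>i a\<^sub>i a\<^sub>i\<^sup>T / f\<^sub>i\<^sup>2\<close>, which is negative definite. Then the critical equations
    generate the maximal ideal of the local ring (\<open>local_ideal_eq_vanishing\<close>).

  If \<open>a\<close> has a kernel, all regions are unbounded and critical points come in infinite families.
  Existence of a critical point does not depend on \<open>u\<close> (\<open>critical_points_all_data\<close>), so finiteness
  for a single data vector excludes critical points for all of them, and both counts are zero.
\<close>

section \<open>Chambers\<close>

text \<open>
  The region of the arrangement that contains \<open>x\<close>, described by signs. If \<open>x\<close> lies on a hyperplane,
  the set is empty.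
\<close>

definition chamber :: "real^'d^'n \<Rightarrow> real^'n \<Rightarrow> real^'d \<Rightarrow> (real^'d) set" where
  "chamber a c x = {y. \<forall>i. 0 < lin_poly a c i x * lin_poly a c i y}"

lemma lin_poly_real: "lin_poly a c i (x::real^'d) = (a *v x + c) $ i"
  by (simp add: lin_poly_def matrix_vector_mult_def)

lemma lin_poly_add:
  "lin_poly a c i (x + v) = lin_poly a c i x + (\<Sum>j\<in>UNIV. of_real (a $ i $ j) * v $ j)"
  by (simp add: lin_poly_def algebra_simps sum.distrib)

lemma lin_poly_add_real:
  "lin_poly a c i (x + v) = lin_poly a c i x + (a *v v) $ i" for x :: "real^'d"
  by (simp add: lin_poly_real matrix_vector_right_distrib)

lemma lin_poly_convex_combination:
  "s + t = 1 \<Longrightarrow> lin_poly a c i (s *\<^sub>R x + t *\<^sub>R y) = s * lin_poly a c i x + t * lin_poly a c i y"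
  for x :: "real^'d"
proof -
  assume st: "s + t = 1"
  have "c $ i = (s + t) * c $ i" using st by simp
  then show ?thesis
    by (simp add: lin_poly_real matrix_vector_right_distrib matrix_vector_mult_scaleR algebra_simps)
qed

lemma continuous_lin_poly: "continuous_on S (lin_poly a c i :: real^'d \<Rightarrow> real)"
  unfolding lin_poly_def by (intro continuous_intros)

lemma mem_real_complement: "x \<in> real_complement a c \<longleftrightarrow> (\<forall>i. lin_poly a c i x \<noteq> 0)"
  by (auto simp: real_complement_def)

lemma mem_chamber_self: "x \<in> chamber a c x \<longleftrightarrow> x \<in> real_complement a c"
  by (auto simp: chamber_def mem_real_complement zero_less_mult_iff linorder_neq_iff)

lemma chamber_subset_complement: "chamber a c x \<subseteq> real_complement a c"
  by (auto simp: chamber_def mem_real_complement) (metis less_irrefl mult_zero_right)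

lemma convex_chamber: "convex (chamber a c x)"
proof (rule convexI)
  fix y z and s t :: real
  assume yz: "y \<in> chamber a c x" "z \<in> chamber a c x" and st: "0 \<le> s" "0 \<le> t" "s + t = 1"
  show "s *\<^sub>R y + t *\<^sub>R z \<in> chamber a c x"
    unfolding chamber_def
  proof (intro CollectI allI)
    fix i
    let ?X = "lin_poly a c i x"
    have pos: "0 < ?X * lin_poly a c i y" "0 < ?X * lin_poly a c i z"
      using yz by (auto simp: chamber_def)
    have "0 < s * (?X * lin_poly a c i y) + t * (?X * lin_poly a c i z)"
    proof (cases "s = 0")
      case True
      then show ?thesis using st pos by simp
    next
      case False
      then have "0 < s * (?X * lin_poly a c i y)" using st pos by simp
      moreover have "0 \<le> t * (?X * lin_poly a c i z)" using st pos by simp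
      ultimately show ?thesis by linarith
    qed
    then show "0 < ?X * lin_poly a c i (s *\<^sub>R y + t *\<^sub>R z)"
      using st by (simp add: lin_poly_convex_combination algebra_simps)
  qed
qed

text \<open>
  A chamber is convex, hence connected; conversely no \<open>f\<^sub>i\<close> can change sign on a connected set that
  avoids its zeros, by the intermediate value theorem.
\<close>

lemma connected_component_eq_chamber:
  assumes x: "x \<in> real_complement a c"
  shows "connected_component_set (real_complement a c) x = chamber a c x" (is "?C = _")
proof
  show "chamber a c x \<subseteq> ?C"
    using x by (intro connected_component_maximal)
      (auto simp: mem_chamber_self convex_chamber convex_connected dest: subsetD[OF chamber_subset_complement])
next
  show "?C \<subseteq> chamber a c x"
  proof
    fix y assume y: "y \<in> ?C"
    have sub: "?C \<subseteq> real_complement a c" by (rule connected_component_subset)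
    have xC: "x \<in> ?C" using x by simp
    show "y \<in> chamber a c x"
      unfolding chamber_def
    proof (intro CollectI allI)
      fix i
      let ?f = "lin_poly a c i :: real^'a \<Rightarrow> real"
      have conn: "connected (?f ` ?C)"
        by (intro connected_continuous_image continuous_lin_poly connected_connected_component)
      have nz: "0 \<notin> ?f ` ?C" using sub by (force simp: mem_real_complement)
      have fx: "?f x \<in> ?f ` ?C" and fy: "?f y \<in> ?f ` ?C" using xC y by auto
      have "\<not> (?f x < 0 \<and> 0 < ?f y)" "\<not> (?f y < 0 \<and> 0 < ?f x)"
        using connectedD_interval[OF conn fx fy, of 0] connectedD_interval[OF conn fy fx, of 0] nz
        by auto
      moreover have "?f x \<noteq> 0" "?f y \<noteq> 0" using nz fx fy by auto
      ultimately show "0 < ?f x * ?f y"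
        by (auto simp: zero_less_mult_iff)
    qed
  qed
qed

lemma components_eq_chambers:
  "components (real_complement a c) = chamber a c ` real_complement a c"
  by (auto simp: components_def connected_component_eq_chamber)

lemma bounded_regions_eq:
  "bounded_regions a c = {chamber a c x |x. x \<in> real_complement a c \<and> bounded (chamber a c x)}"
  by (auto simp: bounded_regions_def components_eq_chambers)

lemma chamber_eqI: "y \<in> chamber a c x \<Longrightarrow> chamber a c y = chamber a c x"
proof -
  assume y: "y \<in> chamber a c x"
  have "(0 < lin_poly a c i y * t) = (0 < lin_poly a c i x * t)" for i t
  proof -
    have "0 < lin_poly a c i x * lin_poly a c i y" using y by (simp add: chamber_def)
    then show ?thesis by (auto simp: zero_less_mult_iff)
  qed
  then show ?thesis by (auto simp: chamber_def)
qed

text \<open>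
  A region is determined by the set of indices at which \<open>f\<^sub>i\<close> is positive.
\<close>

lemma finite_bounded_regions: "finite (bounded_regions a c)"
proof -
  have "components (real_complement a c) \<subseteq>
        (\<lambda>P. {y. \<forall>i. (if i \<in> P then 0 < lin_poly a c i y else lin_poly a c i y < 0)}) ` UNIV"
  proof
    fix R assume "R \<in> components (real_complement a c)"
    then obtain x where x: "x \<in> real_complement a c" and R: "R = chamber a c x"
      by (auto simp: components_eq_chambers)
    have "R = {y. \<forall>i. (if i \<in> {i. 0 < lin_poly a c i x} then 0 < lin_poly a c i y
               else lin_poly a c i y < 0)}"
      using x unfolding R chamber_def mem_real_complement
      by (intro Collect_cong all_cong1) (auto simp: zero_less_mult_iff linorder_neq_iff)
    then show "R \<in> (\<lambda>P. {y. \<forall>i. (if i \<in> P then 0 < lin_poly a c i y else lin_poly a c i y < 0)}) ` UNIV"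
      by blast
  qed
  then have "finite (components (real_complement a c))" by (rule finite_subset) simp
  then show ?thesis by (simp add: bounded_regions_def)
qed

section \<open>Real critical points\<close>

text \<open>
  The critical equations in coordinate-free form: the derivative of \<open>\<Sum>\<^sub>i u\<^sub>i ln \<bar>f\<^sub>i\<bar>\<close> vanishes in every
  direction. Existence, uniqueness and boundedness all use it for a well chosen direction.
\<close>

definition real_critical_points :: "real^'d^'n \<Rightarrow> real^'n \<Rightarrow> nat^'n \<Rightarrow> (real^'d) set" where
  "real_critical_points a c u =
     {x \<in> real_complement a c. \<forall>v. (\<Sum>i\<in>UNIV. real (u $ i) * (a *v v) $ i / lin_poly a c i x) = 0}"

text \<open>
  Since \<open>f\<^sub>i(y) = f\<^sub>i(x) + a\<^sub>i \<cdot> (y - x)\<close>, criticality in the direction \<open>y - x\<close> makes the weighted sum of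
  the ratios \<open>f\<^sub>i(y) / f\<^sub>i(x)\<close> constant. All ratios are positive on the chamber and all weights are at
  least one, so each ratio is at most \<open>\<Sum>\<^sub>i u\<^sub>i\<close>. Bounding the image under \<open>f\<close> instead of the chamber
  itself covers matrices with a kernel.
\<close>

lemma chamber_of_critical_point_bounded:
  assumes x: "x \<in> real_critical_points a c u" and u: "data_vector u"
  shows "bounded ((\<lambda>y. a *v y + c) ` chamber a c x)"
proof -
  let ?f = "\<lambda>i. lin_poly a c i :: real^'a \<Rightarrow> real"
  define U where "U = (\<Sum>i\<in>UNIV. real (u $ i))"
  have nz: "?f i x \<noteq> 0" for i using x by (simp add: real_critical_points_def mem_real_complement)
  have bound: "\<bar>?f i y\<bar> \<le> U * \<bar>?f i x\<bar>" if y: "y \<in> chamber a c x" for y i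
  proof -
    have "real (u $ k) * ?f k y / ?f k x =
        real (u $ k) + real (u $ k) * (a *v (y - x)) $ k / ?f k x" for k
      using nz[of k] lin_poly_add_real[of a c k x "y - x"] by (simp add: field_simps)
    then have "(\<Sum>k\<in>UNIV. real (u $ k) * ?f k y / ?f k x) = U"
      using x by (simp add: sum.distrib U_def real_critical_points_def)
    moreover have pos: "0 < ?f k y / ?f k x" for k
      using y by (auto simp: chamber_def zero_less_mult_iff zero_less_divide_iff)
    have "real (u $ i) * ?f i y / ?f i x \<le> (\<Sum>k\<in>UNIV. real (u $ k) * ?f k y / ?f k x)"
    proof (rule member_le_sum)
      fix k show "0 \<le> real (u $ k) * ?f k y / ?f k x"
        using pos[of k] mult_nonneg_nonneg[of "real (u $ k)" "?f k y / ?f k x"] by simp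
    qed auto
    ultimately have le: "real (u $ i) * (?f i y / ?f i x) \<le> U" by simp
    have "1 \<le> real (u $ i)" using u by (simp add: data_vector_def Suc_leI)
    then have "1 * (?f i y / ?f i x) \<le> real (u $ i) * (?f i y / ?f i x)"
      using pos[of i] by (intro mult_right_mono) auto
    with le have "\<bar>?f i y / ?f i x\<bar> \<le> U" using pos[of i] by simp
    then show ?thesis using nz[of i] by (simp add: abs_divide divide_le_eq)
  qed
  have "norm (a *v y + c) \<le> (\<Sum>i\<in>UNIV. U * \<bar>?f i x\<bar>)" if "y \<in> chamber a c x" for y
    by (rule order_trans[OF norm_le_l1_cart]) (use bound[OF that] in \<open>auto simp: lin_poly_real intro!: sum_mono\<close>)
  then show ?thesis by (auto simp: bounded_iff)
qed

text \<open>
  The product is maximized over the closure of the image of the chamber under \<open>f\<close>. This closure is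
  compact even when \<open>a\<close> has a kernel and the chamber itself is unbounded. The product vanishes on
  the boundary and is positive at \<open>f(x)\<close>, so its maximum is the image of a point of the chamber,
  where the logarithmic derivative must vanish in every direction.
\<close>

lemma critical_point_exists:
  assumes x: "x \<in> real_complement a c" and u: "data_vector u"
    and bdd: "bounded ((\<lambda>y. a *v y + c) ` chamber a c x)"
  obtains z where "z \<in> chamber a c x" "z \<in> real_critical_points a c u"
proof -
  let ?f = "\<lambda>i. lin_poly a c i :: real^'a \<Rightarrow> real"
  let ?F = "\<lambda>y. a *v y + c"
  (* The factors f i x fix the signs, so that every base in the product is nonnegative on H. *)
  define H where "H = {w :: real^'b. \<forall>i. 0 \<le> ?f i x * w $ i}"
  define \<phi> where "\<phi> w = (\<Prod>i\<in>UNIV. (?f i x * w $ i) ^ (u $ i))" for w :: "real^'b"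
  have xnz: "?f i x \<noteq> 0" for i using x by (simp add: mem_real_complement)
  have F: "?F y $ i = ?f i y" for i y by (simp add: lin_poly_real)
  have "closed (range ?F)"
  proof -
    have "range ?F = (+) c ` range ((*v) a)" by (auto simp: image_iff add.commute)
    moreover have "closed (range ((*v) a))"
      by (intro closed_subspace linear_subspace_image) auto
    ultimately show ?thesis by (simp add: closed_translation)
  qed
  moreover have "closed H"
    unfolding H_def by (intro closed_Collect_all closed_Collect_le continuous_intros)
  moreover have "bounded (range ?F \<inter> H)"
  proof (rule bounded_subset)
    show "bounded ((\<lambda>w. 2 *\<^sub>R w - ?F x) ` ?F ` chamber a c x)"
      using bounded_translation_minus[OF bounded_scaling[OF bdd, of 2], of "?F x"]
      by (simp add: image_image)
    (* The midpoint of x and a point of the closed chamber lies in the open chamber. *)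
    show "range ?F \<inter> H \<subseteq> (\<lambda>w. 2 *\<^sub>R w - ?F x) ` ?F ` chamber a c x"
    proof
      fix w assume "w \<in> range ?F \<inter> H"
      then obtain y where w: "w = ?F y" and H: "\<And>i. 0 \<le> ?f i x * ?f i y"
        by (auto simp: H_def F simp del: vector_add_component)
      define m where "m = (1/2) *\<^sub>R x + (1/2) *\<^sub>R y"
      have fm: "?f i m = (?f i x + ?f i y) / 2" for i
        unfolding m_def by (subst lin_poly_convex_combination) auto
      have "0 < ?f i x * ?f i m" for i
      proof -
        have "0 < ?f i x * ?f i x" using xnz[of i] by (auto simp: zero_less_mult_iff linorder_neq_iff)
        then show ?thesis using H[of i] by (simp add: fm field_simps)
      qed
      then have "m \<in> chamber a c x" by (simp add: chamber_def)
      moreover have "w = 2 *\<^sub>R ?F m - ?F x"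
        unfolding w using fm by (simp add: vec_eq_iff F[symmetric] field_simps)
      ultimately show "w \<in> (\<lambda>w. 2 *\<^sub>R w - ?F x) ` ?F ` chamber a c x" by blast
    qed
  qed
  ultimately have "compact (range ?F \<inter> H)"
    by (simp add: compact_eq_bounded_closed closed_Int)
  moreover have FxK: "?F x \<in> range ?F \<inter> H" by (auto simp: H_def F simp del: vector_add_component)
  moreover have "continuous_on (range ?F \<inter> H) \<phi>"
    unfolding \<phi>_def by (intro continuous_intros)
  ultimately obtain w where w: "w \<in> range ?F \<inter> H" and max: "\<And>w'. w' \<in> range ?F \<inter> H \<Longrightarrow> \<phi> w' \<le> \<phi> w"
    using continuous_attains_sup[of "range ?F \<inter> H" \<phi>] by blast
  obtain z where z: "w = ?F z" using w by blast
  have "0 < \<phi> (?F x)"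
    unfolding \<phi>_def F by (intro prod_pos zero_less_power ballI) (use xnz in \<open>auto simp: zero_less_mult_iff linorder_neq_iff\<close>)
  then have pos: "0 < \<phi> w" using max[OF FxK] by linarith
  have zpos: "0 < ?f i x * ?f i z" for i
  proof -
    have "?f i x * ?f i z \<noteq> 0"
    proof
      assume "?f i x * ?f i z = 0"
      then have "\<phi> w = 0"
        unfolding \<phi>_def z F using u by (intro prod_zero) (auto simp: data_vector_def intro!: bexI[of _ i])
      with pos show False by simp
    qed
    moreover have "0 \<le> ?f i x * ?f i z"
      using w unfolding z H_def by (simp add: F del: vector_add_component)
    ultimately show ?thesis by linarith
  qed
  then have zR: "z \<in> chamber a c x" by (simp add: chamber_def)
  have ln\<phi>: "ln (\<phi> (?F y)) = (\<Sum>i\<in>UNIV. real (u $ i) * ln (?f i x * ?f i y))"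
    if "y \<in> chamber a c x" for y
  proof -
    have "?f i x * ?f i y \<noteq> 0" for i using that by (auto simp: chamber_def dest: spec[of _ i])
    then show ?thesis unfolding \<phi>_def F by (subst ln_prod) (auto simp: ln_realpow)
  qed
  have "(\<Sum>i\<in>UNIV. real (u $ i) * (a *v v) $ i / ?f i z) = 0" for v
  proof -
    define \<psi> where "\<psi> t = (\<Sum>i\<in>UNIV. real (u $ i) * ln (?f i x * ?f i (z + t *\<^sub>R v)))" for t
    have line: "?f i (z + t *\<^sub>R v) = ?f i z + t * (a *v v) $ i" for i t
      by (simp add: lin_poly_add_real matrix_vector_mult_scaleR)
    have "((\<lambda>t. real (u $ i) * ln (?f i x * (?f i z + t * (a *v v) $ i))) has_real_derivative
             real (u $ i) * (a *v v) $ i / ?f i z) (at 0)" for i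
      using zpos[of i] xnz[of i] by (auto intro!: derivative_eq_intros simp: field_simps)
    then have der: "(\<psi> has_real_derivative (\<Sum>i\<in>UNIV. real (u $ i) * (a *v v) $ i / ?f i z)) (at 0)"
      unfolding \<psi>_def line by (intro DERIV_sum)
    have "\<forall>\<^sub>F t in nhds 0. \<forall>i\<in>UNIV. 0 < ?f i x * (?f i z + t * (a *v v) $ i)"
    proof (intro eventually_ball_finite ballI)
      fix i
      have "((\<lambda>t. ?f i x * (?f i z + t * (a *v v) $ i)) \<longlongrightarrow> ?f i x * (?f i z + 0 * (a *v v) $ i)) (nhds 0)"
        by (intro tendsto_intros filterlim_ident)
      then show "\<forall>\<^sub>F t in nhds 0. 0 < ?f i x * (?f i z + t * (a *v v) $ i)"
        using zpos[of i] by (auto dest: order_tendstoD(1))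
    qed simp
    then obtain \<delta> where \<delta>: "0 < \<delta>" and near: "\<And>t. dist t 0 < \<delta> \<Longrightarrow> z + t *\<^sub>R v \<in> chamber a c x"
      unfolding eventually_nhds_metric chamber_def by (auto simp: line)
    have "\<psi> t \<le> \<psi> 0" if t: "\<bar>0 - t\<bar> < \<delta>" for t
    proof -
      have R: "z + t *\<^sub>R v \<in> chamber a c x" using near[of t] t by simp
      then have "?F (z + t *\<^sub>R v) \<in> range ?F \<inter> H"
        by (auto simp: H_def F chamber_def less_imp_le simp del: vector_add_component)
      then have "\<phi> (?F (z + t *\<^sub>R v)) \<le> \<phi> (?F z)" using max z by blast
      moreover have "0 < \<phi> (?F (z + t *\<^sub>R v))"
        using R unfolding \<phi>_def F chamber_def by (intro prod_pos) auto
      ultimately have "ln (\<phi> (?F (z + t *\<^sub>R v))) \<le> ln (\<phi> (?F z))" by simp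
      then show ?thesis using ln\<phi>[OF R] ln\<phi>[OF zR] by (simp add: \<psi>_def)
    qed
    then show ?thesis using DERIV_local_max[OF der \<delta>] by blast
  qed
  moreover have "z \<in> real_complement a c" using zR chamber_subset_complement by blast
  ultimately have "z \<in> real_critical_points a c u" by (simp add: real_critical_points_def)
  with zR show ?thesis by (rule that)
qed

text \<open>
  Strict concavity of \<open>\<Sum>\<^sub>i u\<^sub>i ln \<bar>f\<^sub>i\<bar>\<close> modulo the kernel: subtracting the critical equations of \<open>x\<close> and
  \<open>y\<close> in the direction \<open>y - x\<close> leaves the sum of
  \<open>u\<^sub>i (f\<^sub>i(y) - f\<^sub>i(x))\<^sup>2 / (f\<^sub>i(x) f\<^sub>i(y))\<close>, whose terms are nonnegative on a common chamber.
\<close>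

lemma critical_point_unique:
  assumes x: "x \<in> real_critical_points a c u" and y: "y \<in> real_critical_points a c u"
    and yx: "y \<in> chamber a c x" and u: "data_vector u"
  shows "a *v x = a *v y"
proof -
  let ?f = "\<lambda>i. lin_poly a c i :: real^'a \<Rightarrow> real"
  let ?d = "a *v (y - x)"
  have pos: "0 < ?f i x * ?f i y" for i using yx by (simp add: chamber_def)
  have d: "?f i y = ?f i x + ?d $ i" for i
    using lin_poly_add_real[of a c i x "y - x"] by simp
  have t: "real (u $ i) * (?d $ i)\<^sup>2 / (?f i x * ?f i y) =
        real (u $ i) * ?d $ i / ?f i x - real (u $ i) * ?d $ i / ?f i y" for i
  proof -
    have "?f i x \<noteq> 0" "?f i y \<noteq> 0" using pos[of i] by auto
    then have "real (u $ i) * ?d $ i / ?f i x - real (u $ i) * ?d $ i / ?f i y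
        = real (u $ i) * ?d $ i * (?f i y - ?f i x) / (?f i x * ?f i y)"
      by (simp add: field_simps)
    also have "?f i y - ?f i x = ?d $ i" using d[of i] by simp
    finally show ?thesis by (simp add: power2_eq_square mult.assoc)
  qed
  have "(\<Sum>i\<in>UNIV. real (u $ i) * (?d $ i)\<^sup>2 / (?f i x * ?f i y)) = 0"
    using x y by (simp only: t sum_subtractf) (simp add: real_critical_points_def)
  moreover have "0 \<le> real (u $ i) * (?d $ i)\<^sup>2 / (?f i x * ?f i y)" for i
    using pos[of i] by simp
  ultimately have "\<forall>i\<in>UNIV. real (u $ i) * (?d $ i)\<^sup>2 / (?f i x * ?f i y) = 0"
    by (subst (asm) sum_nonneg_eq_0_iff) auto
  then have "\<forall>i. real (u $ i) = 0 \<or> ?d $ i = 0 \<or> ?f i x * ?f i y = 0" by auto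
  moreover have "real (u $ i) \<noteq> 0" "?f i x * ?f i y \<noteq> 0" for i
    using u pos[of i] by (simp add: data_vector_def, linarith)
  ultimately have "?d $ i = 0" for i by blast
  then have "?d = 0" by (simp add: vec_eq_iff)
  then show ?thesis by (simp add: matrix_vector_mult_diff_distrib)
qed

section \<open>Complex critical points\<close>

definition complexify :: "real^'d \<Rightarrow> complex^'d" where
  "complexify x = (\<chi> j. complex_of_real (x $ j))"

definition vec_Re :: "complex^'d \<Rightarrow> real^'d" where "vec_Re \<theta> = (\<chi> j. Re (\<theta> $ j))"
definition vec_Im :: "complex^'d \<Rightarrow> real^'d" where "vec_Im \<theta> = (\<chi> j. Im (\<theta> $ j))"

lemma inj_complexify: "inj complexify"
  by (auto simp: inj_on_def complexify_def vec_eq_iff)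

lemma complexify_vec_Re: "vec_Im \<theta> = 0 \<Longrightarrow> complexify (vec_Re \<theta>) = \<theta>"
  by (simp add: complexify_def vec_Re_def vec_Im_def vec_eq_iff complex_eq_iff)

lemma linear_part_complexify:
  "(\<Sum>j\<in>UNIV. complex_of_real (a $ i $ j) * complexify v $ j) = of_real ((a *v v) $ i)"
  by (simp add: complexify_def matrix_vector_mult_def)

lemma lin_poly_complexify: "lin_poly a c i (complexify x) = of_real (lin_poly a c i x)"
  by (simp add: lin_poly_def complexify_def)

lemma lin_poly_complex:
  "lin_poly a c i \<theta> = Complex (lin_poly a c i (vec_Re \<theta>)) ((a *v vec_Im \<theta>) $ i)"
  by (simp add: complex_eq_iff lin_poly_def vec_Re_def vec_Im_def matrix_vector_mult_def)

lemma critical_point_directional: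
  assumes "\<theta> \<in> critical_points a c u"
  shows "(\<Sum>i\<in>UNIV. of_nat (u $ i) * (\<Sum>j\<in>UNIV. of_real (a $ i $ j) * v $ j) / lin_poly a c i \<theta>) = 0"
proof -
  have "(\<Sum>i\<in>UNIV. of_nat (u $ i) * (\<Sum>j\<in>UNIV. of_real (a $ i $ j) * v $ j) / lin_poly a c i \<theta>)
      = (\<Sum>i\<in>UNIV. \<Sum>j\<in>UNIV. v $ j * (of_nat (u $ i) * of_real (a $ i $ j) / lin_poly a c i \<theta>))"
    by (simp add: sum_distrib_left sum_divide_distrib mult.commute mult.left_commute)
  also have "\<dots> = (\<Sum>j\<in>UNIV. v $ j * critical_eq a c u j \<theta>)"
    by (subst sum.swap) (simp add: critical_eq_def sum_distrib_left)
  also have "\<dots> = 0" using assms by (simp add: critical_points_def)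
  finally show ?thesis .
qed

text \<open>
  In the direction \<open>Im \<theta>\<close> every term of the critical equation has a nonpositive imaginary part, because
  \<open>Im (w / f) = - w Im f / \<bar>f\<bar>\<^sup>2\<close> for real \<open>w\<close>, and here \<open>w\<close> is \<open>Im f\<close> itself.
\<close>

lemma critical_point_Im:
  assumes \<theta>: "\<theta> \<in> critical_points a c u" and u: "data_vector u"
  shows "a *v vec_Im \<theta> = 0"
proof -
  let ?w = "a *v vec_Im \<theta>"
  let ?f = "\<lambda>i. lin_poly a c i \<theta>"
  let ?t = "\<lambda>i. real (u $ i) * (?w $ i)\<^sup>2 / ((Re (?f i))\<^sup>2 + (Im (?f i))\<^sup>2)"
  have nz: "?f i \<noteq> 0" for i using \<theta> by (simp add: critical_points_def)
  have "Im (\<Sum>i\<in>UNIV. of_nat (u $ i) * of_real (?w $ i) / ?f i) = 0"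
    using critical_point_directional[OF \<theta>, of "complexify (vec_Im \<theta>)"]
    by (simp add: linear_part_complexify)
  moreover have "Im (of_nat (u $ i) * of_real (?w $ i) / ?f i) = - ?t i" for i
    by (simp add: Im_divide lin_poly_complex power2_eq_square)
  ultimately have "(\<Sum>i\<in>UNIV. ?t i) = 0" by (simp add: sum_negf)
  then have "\<forall>i\<in>UNIV. ?t i = 0" by (subst (asm) sum_nonneg_eq_0_iff) auto
  moreover have "real (u $ i) \<noteq> 0" for i using u by (simp add: data_vector_def)
  moreover have "(Re (?f i))\<^sup>2 + (Im (?f i))\<^sup>2 \<noteq> 0" for i
    using nz[of i] by (metis complex_neq_0 less_irrefl)
  ultimately have "?w $ i = 0" for i by (simp del: of_nat_eq_0_iff) metis
  then show ?thesis by (simp add: vec_eq_iff)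
qed

lemma vec_Re_critical:
  assumes \<theta>: "\<theta> \<in> critical_points a c u" and u: "data_vector u"
  shows "vec_Re \<theta> \<in> real_critical_points a c u"
proof -
  have f: "lin_poly a c i \<theta> = of_real (lin_poly a c i (vec_Re \<theta>))" for i
    using critical_point_Im[OF \<theta> u] by (simp add: lin_poly_complex complex_eq_iff)
  have "vec_Re \<theta> \<in> real_complement a c"
    using \<theta> by (auto simp: mem_real_complement critical_points_def f)
  moreover have "(\<Sum>i\<in>UNIV. real (u $ i) * (a *v v) $ i / lin_poly a c i (vec_Re \<theta>)) = 0" for v
  proof -
    have "complex_of_real (\<Sum>i\<in>UNIV. real (u $ i) * (a *v v) $ i / lin_poly a c i (vec_Re \<theta>)) = 0"
      using critical_point_directional[OF \<theta>, of "complexify v"]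
      by (simp add: linear_part_complexify f)
    then show ?thesis by (simp only: of_real_eq_0_iff)
  qed
  ultimately show ?thesis by (simp add: real_critical_points_def)
qed

lemma complexify_critical:
  assumes x: "x \<in> real_critical_points a c u"
  shows "complexify x \<in> critical_points a c u"
proof -
  have "critical_eq a c u j (complexify x) = 0" for j
  proof -
    have "(a *v axis j 1) $ i = a $ i $ j" for i
      by (simp add: matrix_vector_mult_basis column_def)
    then have "(\<Sum>i\<in>UNIV. real (u $ i) * a $ i $ j / lin_poly a c i x) = 0"
      using x by (simp add: real_critical_points_def) (metis (no_types, lifting) sum.cong)
    then have "complex_of_real (\<Sum>i\<in>UNIV. real (u $ i) * a $ i $ j / lin_poly a c i x) = 0"
      by (simp only: of_real_0)
    then show ?thesis by (simp add: critical_eq_def lin_poly_complexify)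
  qed
  then show ?thesis
    using x by (simp add: critical_points_def lin_poly_complexify real_critical_points_def mem_real_complement)
qed

text \<open>
  Translating by a kernel vector changes no \<open>f\<^sub>i\<close>.
\<close>

lemma infinite_critical_points:
  assumes \<theta>: "\<theta> \<in> critical_points a c u" and v: "a *v v = 0" "v \<noteq> 0"
  shows "infinite (critical_points a c u)"
proof -
  have "\<theta> + complexify (t *\<^sub>R v) \<in> critical_points a c u" for t
  proof -
    have "lin_poly a c i (\<theta> + complexify (t *\<^sub>R v)) = lin_poly a c i \<theta>" for i
      using v by (simp add: lin_poly_add linear_part_complexify matrix_vector_mult_scaleR)
    then show ?thesis using \<theta> by (simp add: critical_points_def critical_eq_def)
  qed
  then have "range (\<lambda>t. \<theta> + complexify (t *\<^sub>R v)) \<subseteq> critical_points a c u" by blast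
  moreover have "inj (\<lambda>t. \<theta> + complexify (t *\<^sub>R v))"
    using v by (auto simp: inj_on_def dest: injD[OF inj_complexify])
  ultimately show ?thesis
    by (meson infinite_UNIV_char_0 finite_imageD finite_subset)
qed

text \<open>
  A region containing a critical point is bounded because the \<open>f\<^sub>i\<close> are bounded on it and the injective
  map \<open>a\<close> has a linear left inverse. Conversely a bounded region contains exactly one critical point.
\<close>

lemma critical_points_bij_bounded_regions:
  assumes inj: "inj ((*v) a)" and u: "data_vector u"
  shows "bij_betw (\<lambda>\<theta>. chamber a c (vec_Re \<theta>)) (critical_points a c u) (bounded_regions a c)"
proof (rule bij_betw_imageI)
  have recover: "complexify (vec_Re \<theta>) = \<theta>" if "\<theta> \<in> critical_points a c u" for \<theta>
  proof (rule complexify_vec_Re)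
    have "a *v vec_Im \<theta> = a *v 0" using critical_point_Im[OF that u] by simp
    then show "vec_Im \<theta> = 0" by (rule injD[OF inj])
  qed
  show "inj_on (\<lambda>\<theta>. chamber a c (vec_Re \<theta>)) (critical_points a c u)"
  proof (rule inj_onI)
    fix \<theta> \<eta> assume \<theta>: "\<theta> \<in> critical_points a c u" and \<eta>: "\<eta> \<in> critical_points a c u"
      and eq: "chamber a c (vec_Re \<theta>) = chamber a c (vec_Re \<eta>)"
    have "vec_Re \<eta> \<in> chamber a c (vec_Re \<theta>)"
      using vec_Re_critical[OF \<eta> u] eq by (simp add: mem_chamber_self real_critical_points_def)
    then have "a *v vec_Re \<theta> = a *v vec_Re \<eta>"
      using critical_point_unique vec_Re_critical \<theta> \<eta> u by blast
    then have "vec_Re \<theta> = vec_Re \<eta>" by (rule injD[OF inj])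
    then show "\<theta> = \<eta>" using recover \<theta> \<eta> by metis
  qed
  show "(\<lambda>\<theta>. chamber a c (vec_Re \<theta>)) ` critical_points a c u = bounded_regions a c"
  proof (intro subset_antisym subsetI)
    fix R assume "R \<in> (\<lambda>\<theta>. chamber a c (vec_Re \<theta>)) ` critical_points a c u"
    then obtain \<theta> where \<theta>: "\<theta> \<in> critical_points a c u" and R: "R = chamber a c (vec_Re \<theta>)" by blast
    note x = vec_Re_critical[OF \<theta> u]
    obtain L where L: "linear L" "L \<circ> (*v) a = id"
      using linear_injective_left_inverse[OF matrix_vector_mul_linear inj] by blast
    have "bounded ((\<lambda>w. w - c) ` (\<lambda>y. a *v y + c) ` R)"
      using bounded_translation_minus[OF chamber_of_critical_point_bounded[OF x u]] R by simp
    then have "bounded ((*v) a ` R)" by (simp add: image_image)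
    then have "bounded (L ` ((*v) a ` R))"
      using L(1) by (simp only: bounded_linear_image linear_conv_bounded_linear)
    then have "bounded R" using L(2) by (simp add: image_comp)
    then show "R \<in> bounded_regions a c"
      using x R by (auto simp: bounded_regions_eq real_critical_points_def)
  next
    fix R assume "R \<in> bounded_regions a c"
    then obtain x where x: "x \<in> real_complement a c" "bounded (chamber a c x)" and R: "R = chamber a c x"
      by (auto simp: bounded_regions_eq)
    have "bounded ((+) c ` (*v) a ` chamber a c x)"
      using x by (intro bounded_translation bounded_linear_image matrix_vector_mul_bounded_linear)
    then have "bounded ((\<lambda>y. a *v y + c) ` chamber a c x)" by (simp add: image_image add.commute)
    then obtain z where z: "z \<in> chamber a c x" "z \<in> real_critical_points a c u"
      using critical_point_exists[OF x(1) u] by blast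
    have "vec_Re (complexify z) = z" by (simp add: vec_Re_def complexify_def)
    then have "R = chamber a c (vec_Re (complexify z))" using chamber_eqI[OF z(1)] R by simp
    then show "R \<in> (\<lambda>\<theta>. chamber a c (vec_Re \<theta>)) ` critical_points a c u"
      using complexify_critical[OF z(2)] by blast
  qed
qed

text \<open>
  Existence does not depend on the data: a critical point for \<open>u\<close> bounds the \<open>f\<^sub>i\<close> on its
  chamber, and that suffices to find a maximum for \<open>u'\<close>.
\<close>

lemma critical_points_all_data:
  assumes u: "data_vector u" "critical_points a c u \<noteq> {}" and u': "data_vector u'"
  shows "critical_points a c u' \<noteq> {}"
proof -
  obtain \<theta> where \<theta>: "\<theta> \<in> critical_points a c u" using u by blast
  note x = vec_Re_critical[OF \<theta> u(1)]
  then have "vec_Re \<theta> \<in> real_complement a c" by (simp add: real_critical_points_def)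
  then obtain z where "z \<in> real_critical_points a c u'"
    using critical_point_exists[OF _ u' chamber_of_critical_point_bounded[OF x u(1)]] by blast
  then show ?thesis using complexify_critical by blast
qed

lemma unbounded_chamber:
  assumes v: "a *v v = 0" "v \<noteq> 0" and x: "x \<in> real_complement a c"
  shows "\<not> bounded (chamber a c x)"
proof
  assume "bounded (chamber a c x)"
  then obtain B where B: "\<And>y. y \<in> chamber a c x \<Longrightarrow> norm y \<le> B" by (auto simp: bounded_iff)
  have inR: "x + t *\<^sub>R v \<in> chamber a c x" for t
    using x v mem_chamber_self[of x a c]
    by (simp add: chamber_def lin_poly_add_real matrix_vector_mult_scaleR)
  define t where "t = (B + norm x + 1) / norm v"
  have "norm (t *\<^sub>R v) \<le> norm (x + t *\<^sub>R v) + norm x"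
    by (metis add_diff_cancel_left' norm_triangle_ineq4 add.commute)
  also have "\<dots> \<le> B + norm x" using B[OF inR[of t]] by simp
  finally have "\<bar>t\<bar> * norm v \<le> B + norm x" by simp
  moreover have "t * norm v = B + norm x + 1" using v by (simp add: t_def)
  moreover have "t * norm v \<le> \<bar>t\<bar> * norm v" by (intro mult_right_mono) auto
  ultimately show False by linarith
qed

section \<open>Existence of general data\<close>

lemma real_polynomial_nonzero_at_positive_integer:
  fixes p :: "real \<Rightarrow> real"
  assumes "real_polynomial_function p" "p s \<noteq> 0"
  obtains m :: nat where "0 < m" "p (real m) \<noteq> 0"
proof -
  obtain b n where p: "p = (\<lambda>x. \<Sum>i\<le>n. b i * x ^ i)"
    using assms(1) by (auto simp: real_polynomial_function_iff_sum)
  have "\<exists>i\<le>n. b i \<noteq> 0" using assms(2) by (auto simp: p intro: ccontr)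
  then have "finite {x. p x = 0}" unfolding p using polyfun_finite_roots[of b n] by blast
  then have "finite (real -` {x. p x = 0})" by (intro finite_vimageI) (auto simp: inj_on_def)
  then have "infinite ({0<..} - real -` {x. p x = 0})" by (intro Diff_infinite_finite infinite_Ioi)
  then obtain m where "m \<in> {0<..} - real -` {x. p x = 0}" using infinite_imp_nonempty by blast
  then show ?thesis using that by auto
qed

text \<open>
  A polynomial that is nonzero somewhere is nonzero at some point with positive integer coordinates:
  change one coordinate at a time, using that a nonzero polynomial in one variable has finitely many
  roots.
\<close>

lemma general_data_exists:
  fixes P :: "nat^'n \<Rightarrow> bool"
  assumes "for_general_data P"
  obtains u where "data_vector u" "P u"
proof -
  obtain h :: "real^'n \<Rightarrow> real" and x0 where h: "real_polynomial_function h" and x0: "h x0 \<noteq> 0"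
    and P: "\<And>u. data_vector u \<Longrightarrow> h (\<chi> i. of_nat (u $ i)) \<noteq> 0 \<Longrightarrow> P u"
    using assms by (auto simp: for_general_data_def)
  have "finite S \<Longrightarrow> \<exists>x. h x \<noteq> 0 \<and> (\<forall>i\<in>S. \<exists>m::nat. 0 < m \<and> x $ i = real m)" for S :: "'n set"
  proof (induction S rule: finite_induct)
    case empty
    then show ?case using x0 by auto
  next
    case (insert k S)
    then obtain x where x: "h x \<noteq> 0" "\<forall>i\<in>S. \<exists>m::nat. 0 < m \<and> x $ i = real m" by blast
    define l where "l t = x + (t - x $ k) *\<^sub>R axis k 1" for t :: real
    have "polynomial_function l"
      unfolding l_def by (intro polynomial_function_add polynomial_function_const
        polynomial_function_mult polynomial_function_diff polynomial_function_id)
    then have "real_polynomial_function (h \<circ> l)" using h by blast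
    moreover have "(h \<circ> l) (x $ k) \<noteq> 0" using x by (simp add: l_def)
    ultimately obtain m :: nat where m: "0 < m" "(h \<circ> l) (real m) \<noteq> 0"
      by (rule real_polynomial_nonzero_at_positive_integer)
    have "l (real m) $ i = (if i = k then real m else x $ i)" for i
      by (simp add: l_def axis_def)
    then show ?case using m x by (intro exI[of _ "l (real m)"]) auto
  qed
  from this[OF finite[of UNIV]] obtain x m where x: "h x \<noteq> 0" and m: "\<And>i. 0 < m i \<and> x $ i = real (m i)"
    by (metis UNIV_I)
  define u where "u = (\<chi> i. m i)"
  have "(\<chi> i. real (u $ i)) = x" using m by (simp add: u_def vec_eq_iff)
  then have "P u" using P[of u] x m by (simp add: u_def data_vector_def)
  moreover have "data_vector u" using m by (simp add: u_def data_vector_def)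
  ultimately show ?thesis using that by blast
qed


section \<open>Multiplicity one\<close>

lemma complex_polynomial_function_continuous:
  "complex_polynomial_function P \<Longrightarrow> continuous_on UNIV P"
  by (induction rule: complex_polynomial_function.induct) (auto intro!: continuous_intros)

lemma eventually_nonzero:
  assumes "complex_polynomial_function Q" "Q p \<noteq> 0"
  shows "\<forall>\<^sub>F x in nhds p. Q x \<noteq> 0"
proof -
  have "open {x. Q x \<noteq> 0}"
    using complex_polynomial_function_continuous[OF assms(1)]
    by (intro open_Collect_neq continuous_intros)
  then show ?thesis using assms(2) by (auto simp: eventually_nhds)
qed

lemma local_ringI:
  assumes "complex_polynomial_function P" "complex_polynomial_function Q" "Q p \<noteq> 0"
    "\<forall>\<^sub>F x in nhds p. h x = P x / Q x"
  shows "h \<in> local_ring p"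
  using assms by (auto simp: local_ring_def)

text \<open>
  A function in the local ring is divided by \<open>Q\<close>, and division by zero would break the arithmetic of
  fractions, so the neighbourhood is shrunk until \<open>Q\<close> has no zero in it.
\<close>

lemma local_ringE:
  assumes "h \<in> local_ring p"
  obtains P Q where "complex_polynomial_function P" "complex_polynomial_function Q" "Q p \<noteq> 0"
    "\<forall>\<^sub>F x in nhds p. Q x \<noteq> 0 \<and> h x = P x / Q x"
proof -
  obtain P Q where PQ: "complex_polynomial_function P" "complex_polynomial_function Q" "Q p \<noteq> 0"
    "\<forall>\<^sub>F x in nhds p. h x = P x / Q x" using assms by (auto simp: local_ring_def)
  have "\<forall>\<^sub>F x in nhds p. Q x \<noteq> 0 \<and> h x = P x / Q x"
    using eventually_nonzero[OF PQ(2,3)] PQ(4) by eventually_elim simp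
  with PQ show ?thesis using that by blast
qed

lemma polynomial_in_local_ring: "complex_polynomial_function P \<Longrightarrow> P \<in> local_ring p"
  by (rule local_ringI[where Q = "\<lambda>_. 1"]) (auto intro: complex_polynomial_function.intros)

lemma local_ring_const: "(\<lambda>x. k) \<in> local_ring p"
  by (intro polynomial_in_local_ring complex_polynomial_function.const)

lemma local_ring_add:
  assumes "h \<in> local_ring p" "k \<in> local_ring p"
  shows "(\<lambda>x. h x + k x) \<in> local_ring p"
proof -
  obtain P Q where PQ: "complex_polynomial_function P" "complex_polynomial_function Q" "Q p \<noteq> 0"
    "\<forall>\<^sub>F x in nhds p. Q x \<noteq> 0 \<and> h x = P x / Q x" using assms(1) by (rule local_ringE)
  obtain P' Q' where PQ': "complex_polynomial_function P'" "complex_polynomial_function Q'" "Q' p \<noteq> 0"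
    "\<forall>\<^sub>F x in nhds p. Q' x \<noteq> 0 \<and> k x = P' x / Q' x" using assms(2) by (rule local_ringE)
  show ?thesis
  proof (rule local_ringI)
    show "complex_polynomial_function (\<lambda>x. P x * Q' x + P' x * Q x)"
      "complex_polynomial_function (\<lambda>x. Q x * Q' x)"
      using PQ PQ' by (auto intro!: complex_polynomial_function.intros)
    show "Q p * Q' p \<noteq> 0" using PQ PQ' by simp
    show "\<forall>\<^sub>F x in nhds p. h x + k x = (P x * Q' x + P' x * Q x) / (Q x * Q' x)"
      using PQ(4) PQ'(4) by eventually_elim (simp add: field_simps)
  qed
qed

lemma local_ring_mult:
  assumes "h \<in> local_ring p" "k \<in> local_ring p"
  shows "(\<lambda>x. h x * k x) \<in> local_ring p"
proof -
  obtain P Q where PQ: "complex_polynomial_function P" "complex_polynomial_function Q" "Q p \<noteq> 0"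
    "\<forall>\<^sub>F x in nhds p. Q x \<noteq> 0 \<and> h x = P x / Q x" using assms(1) by (rule local_ringE)
  obtain P' Q' where PQ': "complex_polynomial_function P'" "complex_polynomial_function Q'" "Q' p \<noteq> 0"
    "\<forall>\<^sub>F x in nhds p. Q' x \<noteq> 0 \<and> k x = P' x / Q' x" using assms(2) by (rule local_ringE)
  show ?thesis
  proof (rule local_ringI)
    show "complex_polynomial_function (\<lambda>x. P x * P' x)"
      "complex_polynomial_function (\<lambda>x. Q x * Q' x)"
      using PQ PQ' by (auto intro!: complex_polynomial_function.intros)
    show "Q p * Q' p \<noteq> 0" using PQ PQ' by simp
    show "\<forall>\<^sub>F x in nhds p. h x * k x = (P x * P' x) / (Q x * Q' x)"
      using PQ(4) PQ'(4) by eventually_elim simp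
  qed
qed

lemma local_ring_inverse:
  assumes "h \<in> local_ring p" "h p \<noteq> 0"
  shows "(\<lambda>x. inverse (h x)) \<in> local_ring p"
proof -
  obtain P Q where PQ: "complex_polynomial_function P" "complex_polynomial_function Q" "Q p \<noteq> 0"
    "\<forall>\<^sub>F x in nhds p. Q x \<noteq> 0 \<and> h x = P x / Q x" using assms(1) by (rule local_ringE)
  have "P p \<noteq> 0" using eventually_nhds_x_imp_x[OF PQ(4)] assms(2) by auto
  moreover have "\<forall>\<^sub>F x in nhds p. inverse (h x) = Q x / P x"
    using PQ(4) by eventually_elim (simp add: field_simps)
  ultimately show ?thesis using PQ by (intro local_ringI)
qed

lemma local_ring_divide:
  assumes "h \<in> local_ring p" "k \<in> local_ring p" "k p \<noteq> 0"
  shows "(\<lambda>x. h x / k x) \<in> local_ring p"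
  using local_ring_mult[OF assms(1) local_ring_inverse[OF assms(2,3)]] by (simp add: divide_inverse)

lemma local_ring_sum:
  "(\<And>i. i \<in> A \<Longrightarrow> h i \<in> local_ring p) \<Longrightarrow> (\<lambda>x. \<Sum>i\<in>A. h i x) \<in> local_ring p"
  by (induction A rule: infinite_finite_induct) (auto intro: local_ring_const local_ring_add)

lemma local_ring_prod:
  "(\<And>i. i \<in> A \<Longrightarrow> h i \<in> local_ring p) \<Longrightarrow> (\<lambda>x. \<Prod>i\<in>A. h i x) \<in> local_ring p"
  by (induction A rule: infinite_finite_induct) (auto intro: local_ring_const local_ring_mult)

lemma local_ring_det:
  "(\<And>i j. N i j \<in> local_ring p) \<Longrightarrow> (\<lambda>x. det (\<chi> i j. N i j x)) \<in> local_ring p"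
  unfolding det_def
  by (simp, intro local_ring_sum local_ring_mult local_ring_const local_ring_prod)

lemma local_ring_nonzero:
  assumes "h \<in> local_ring p" "h p \<noteq> 0"
  shows "\<forall>\<^sub>F x in nhds p. h x \<noteq> 0"
proof -
  obtain P Q where PQ: "complex_polynomial_function P" "complex_polynomial_function Q" "Q p \<noteq> 0"
    "\<forall>\<^sub>F x in nhds p. Q x \<noteq> 0 \<and> h x = P x / Q x" using assms(1) by (rule local_ringE)
  have "P p \<noteq> 0" using eventually_nhds_x_imp_x[OF PQ(4)] assms(2) by auto
  from eventually_nonzero[OF PQ(1) this] PQ(4) show ?thesis by eventually_elim simp
qed

text \<open>
  The coordinate differences generate the ideal of polynomials vanishing at \<open>p\<close>, by the product rule
  \<open>PQ - P(p)Q(p) = (P - P(p)) Q + P(p) (Q - Q(p))\<close>.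
\<close>

lemma complex_polynomial_taylor:
  assumes "complex_polynomial_function P"
  shows "\<exists>R. (\<forall>k. complex_polynomial_function (R k)) \<and>
             (\<forall>x. P x = P p + (\<Sum>k\<in>UNIV. R k x * (x $ k - p $ k)))"
  using assms
proof (induction rule: complex_polynomial_function.induct)
  case (const k)
  then show ?case
    by (intro exI[of _ "\<lambda>_ _. 0"]) (auto intro: complex_polynomial_function.const)
next
  case (coord j)
  have "(\<Sum>k\<in>UNIV. (if k = j then 1 else 0) * (x $ k - p $ k)) = x $ j - p $ j" for x
    by (simp add: if_distrib[where f = "\<lambda>t. t * _"] cong: if_cong)
  then show ?case
    by (intro exI[of _ "\<lambda>k _. if k = j then 1 else 0"])
      (auto intro: complex_polynomial_function.const)
next
  case (add P Q)
  then obtain R S where R: "\<And>k. complex_polynomial_function (R k)"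
      "\<And>x. P x = P p + (\<Sum>k\<in>UNIV. R k x * (x $ k - p $ k))"
    and S: "\<And>k. complex_polynomial_function (S k)"
      "\<And>x. Q x = Q p + (\<Sum>k\<in>UNIV. S k x * (x $ k - p $ k))" by auto
  show ?case
  proof (intro exI[of _ "\<lambda>k x. R k x + S k x"] conjI allI)
    fix x
    show "P x + Q x = P p + Q p + (\<Sum>k\<in>UNIV. (R k x + S k x) * (x $ k - p $ k))"
      by (subst R(2), subst S(2)) (simp add: distrib_right sum.distrib)
  qed (use R(1) S(1) in \<open>auto intro!: complex_polynomial_function.intros\<close>)
next
  case (mult P Q)
  then obtain R S where R: "\<And>k. complex_polynomial_function (R k)"
      "\<And>x. P x = P p + (\<Sum>k\<in>UNIV. R k x * (x $ k - p $ k))"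
    and S: "\<And>k. complex_polynomial_function (S k)"
      "\<And>x. Q x = Q p + (\<Sum>k\<in>UNIV. S k x * (x $ k - p $ k))" by auto
  show ?case
  proof (intro exI[of _ "\<lambda>k x. R k x * Q x + P p * S k x"] conjI allI)
    fix x
    have "P x * Q x = P p * Q p + (\<Sum>k\<in>UNIV. R k x * (x $ k - p $ k)) * Q x
        + P p * (\<Sum>k\<in>UNIV. S k x * (x $ k - p $ k))"
      using R(2)[of x] S(2)[of x] by (simp add: algebra_simps)
    moreover have "(\<Sum>k\<in>UNIV. (R k x * Q x + P p * S k x) * (x $ k - p $ k))
        = (\<Sum>k\<in>UNIV. R k x * (x $ k - p $ k) * Q x + P p * (S k x * (x $ k - p $ k)))"
      by (intro sum.cong) (auto simp: algebra_simps)
    ultimately show "P x * Q x = P p * Q p + (\<Sum>k\<in>UNIV. (R k x * Q x + P p * S k x) * (x $ k - p $ k))"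
      by (simp add: sum_distrib_left sum_distrib_right sum.distrib)
  qed (use R(1) S(1) mult.hyps in \<open>auto intro!: complex_polynomial_function.intros\<close>)
qed

text \<open>
  A matrix over the local ring whose determinant does not vanish at \<open>p\<close> is invertible over the local
  ring: Cramer's rule expresses the entries of the inverse as quotients of determinants. So the system
  \<open>g\<close> can be solved for the coordinate differences.
\<close>

lemma local_ring_linear_system:
  fixes g :: "'d::finite \<Rightarrow> complex^'d \<Rightarrow> complex"
  assumes N: "\<And>j k. N j k \<in> local_ring p" and det: "det (\<chi> j k. N j k p) \<noteq> 0"
    and g: "\<forall>\<^sub>F x in nhds p. \<forall>j. g j x = (\<Sum>k\<in>UNIV. N j k x * (x $ k - p $ k))"
  obtains W where "\<And>k j. W k j \<in> local_ring p"
    "\<forall>\<^sub>F x in nhds p. \<forall>k. x $ k - p $ k = (\<Sum>j\<in>UNIV. W k j x * g j x)"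
proof -
  define M :: "complex^'d \<Rightarrow> complex^'d^'d" where "M x = (\<chi> j k. N j k x)" for x
  define W where "W k l x =
    det (\<chi> i j. if j = k then if i = l then 1 else 0 else N i j x) / det (M x)" for k l x
  have detL: "(\<lambda>x. det (M x)) \<in> local_ring p" unfolding M_def by (rule local_ring_det) (rule N)
  have detp: "det (M p) \<noteq> 0" using det by (simp add: M_def)
  have W: "W k l \<in> local_ring p" for k l
  proof -
    have "(\<lambda>x. if j = k then if i = l then 1 else 0 else N i j x) \<in> local_ring p" for i j
      by (cases "j = k"; cases "i = l") (simp_all add: local_ring_const N)
    then have "(\<lambda>x. det (\<chi> i j. if j = k then if i = l then 1 else 0 else N i j x)) \<in> local_ring p"
      by (rule local_ring_det)
    then show ?thesis using local_ring_divide[OF _ detL detp] unfolding W_def[abs_def] by blast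
  qed
  have "\<forall>\<^sub>F x in nhds p. \<forall>k. x $ k - p $ k = (\<Sum>j\<in>UNIV. W k j x * g j x)"
    using g local_ring_nonzero[OF detL detp]
  proof eventually_elim
    fix x assume gx: "\<forall>j. g j x = (\<Sum>k\<in>UNIV. N j k x * (x $ k - p $ k))" and d: "det (M x) \<noteq> 0"
    define V where "V = (\<chi> k l. W k l x)"
    (* By Cramer's rule, column l of V solves the system with the l-th unit vector on the right. *)
    have col: "M x *v column l V = axis l 1" for l
      unfolding cramer[OF d]
      by (simp add: V_def W_def M_def column_def vec_eq_iff axis_def cong: if_cong)
    have "M x ** V = mat 1"
      by (simp add: vec_eq_iff matrix_matrix_mult_def mat_def)
        (use col in \<open>auto simp: vec_eq_iff matrix_vector_mult_def column_def axis_def\<close>)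
    then have VM: "V ** M x = mat 1" by (rule matrix_left_right_inverse1)
    have "(\<chi> j. g j x) = M x *v (x - p)"
      using gx by (simp add: vec_eq_iff matrix_vector_mult_def M_def)
    then have "V *v (\<chi> j. g j x) = x - p"
      using VM by (simp add: matrix_vector_mul_assoc)
    then show "\<forall>k. x $ k - p $ k = (\<Sum>j\<in>UNIV. W k j x * g j x)"
      by (simp add: vec_eq_iff matrix_vector_mult_def V_def)
  qed
  with W show ?thesis by (rule that)
qed

text \<open>
  A form of Nakayama's lemma for a system whose Jacobian at \<open>p\<close> is invertible: the coordinate
  differences, which generate the maximal ideal, are combinations of the \<open>g\<^sub>j\<close>.
\<close>

lemma local_ideal_eq_vanishing:
  fixes g :: "'d::finite \<Rightarrow> complex^'d \<Rightarrow> complex"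
  assumes N: "\<And>j k. N j k \<in> local_ring p" and det: "det (\<chi> j k. N j k p) \<noteq> 0"
    and g: "\<forall>\<^sub>F x in nhds p. \<forall>j. g j x = (\<Sum>k\<in>UNIV. N j k x * (x $ k - p $ k))"
  shows "local_ideal g p = {h \<in> local_ring p. h p = 0}"
proof (intro subset_antisym subsetI)
  fix h assume "h \<in> local_ideal g p"
  then obtain r where h: "h \<in> local_ring p" "\<forall>\<^sub>F x in nhds p. h x = (\<Sum>j\<in>UNIV. r j x * g j x)"
    by (auto simp: local_ideal_def)
  have "g j p = 0" for j using eventually_nhds_x_imp_x[OF g] by simp
  then have "h p = 0" using eventually_nhds_x_imp_x[OF h(2)] by simp
  with h show "h \<in> {h \<in> local_ring p. h p = 0}" by simp
next
  fix h assume "h \<in> {h \<in> local_ring p. h p = 0}"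
  then have h: "h \<in> local_ring p" "h p = 0" by auto
  obtain P Q where PQ: "complex_polynomial_function P" "complex_polynomial_function Q" "Q p \<noteq> 0"
    "\<forall>\<^sub>F x in nhds p. Q x \<noteq> 0 \<and> h x = P x / Q x" using h(1) by (rule local_ringE)
  have "P p = 0" using eventually_nhds_x_imp_x[OF PQ(4)] h(2) by auto
  then obtain R where R: "\<And>k. complex_polynomial_function (R k)"
    "\<And>x. P x = (\<Sum>k\<in>UNIV. R k x * (x $ k - p $ k))"
    using complex_polynomial_taylor[OF PQ(1), of p] by auto
  obtain W where W: "\<And>k j. W k j \<in> local_ring p"
    "\<forall>\<^sub>F x in nhds p. \<forall>k. x $ k - p $ k = (\<Sum>j\<in>UNIV. W k j x * g j x)"
    using local_ring_linear_system[OF N det g] by blast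
  define r where "r j x = (\<Sum>k\<in>UNIV. R k x * W k j x) / Q x" for j x
  have "r j \<in> local_ring p" for j
    unfolding r_def[abs_def]
    by (intro local_ring_divide local_ring_sum local_ring_mult W(1)
        polynomial_in_local_ring[OF R(1)] polynomial_in_local_ring[OF PQ(2)] PQ(3))
  moreover have "\<forall>\<^sub>F x in nhds p. h x = (\<Sum>j\<in>UNIV. r j x * g j x)"
    using PQ(4) W(2)
  proof eventually_elim
    fix x assume a: "Q x \<noteq> 0 \<and> h x = P x / Q x"
      and b: "\<forall>k. x $ k - p $ k = (\<Sum>j\<in>UNIV. W k j x * g j x)"
    have "P x = (\<Sum>k\<in>UNIV. \<Sum>j\<in>UNIV. R k x * W k j x * g j x)"
      unfolding R(2) b[rule_format] by (simp add: sum_distrib_left mult.assoc)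
    also have "\<dots> = (\<Sum>j\<in>UNIV. (\<Sum>k\<in>UNIV. R k x * W k j x) * g j x)"
      by (subst sum.swap) (simp add: sum_distrib_right)
    finally show "h x = (\<Sum>j\<in>UNIV. r j x * g j x)"
      using a by (simp add: r_def) (subst sum_divide_distrib, simp)
  qed
  ultimately show "h \<in> local_ideal g p" using h(1) by (auto simp: local_ideal_def)
qed

text \<open>
  The quotient by the maximal ideal is the field of values at \<open>p\<close>, which is one-dimensional: any two
  functions have a nontrivial combination vanishing at \<open>p\<close>, and the constant \<open>1\<close> does not vanish.
\<close>

lemma solution_multiplicity_eq_1:
  assumes ideal: "local_ideal g p = {h \<in> local_ring p. h p = 0}"
  shows "solution_multiplicity g p = 1"
proof -
  let ?indep = "{B. finite B \<and> B \<subseteq> local_ring p \<and>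
    (\<forall>k. (\<lambda>x. \<Sum>b\<in>B. k b * b x) \<in> local_ideal g p \<longrightarrow> (\<forall>b\<in>B. k b = 0))}"
  have "card B \<le> 1" if B: "B \<in> ?indep" for B
  proof (rule ccontr)
    assume "\<not> card B \<le> 1"
    then obtain b1 b2 where b: "b1 \<in> B" "b2 \<in> B" "b1 \<noteq> b2"
      using B by (auto simp: card_le_Suc0_iff_eq)
    have zero: "\<forall>b\<in>B. k b = 0" if "(\<Sum>b\<in>B. k b * b p) = 0" for k
    proof -
      have "(\<lambda>x. \<Sum>b\<in>B. k b * b x) \<in> local_ring p"
        using B by (intro local_ring_sum local_ring_mult local_ring_const) auto
      then show ?thesis using B that by (simp add: ideal)
    qed
    have comb: "(\<Sum>b\<in>B. (if b = b1 then s else if b = b2 then t else 0) * b p) = s * b1 p + t * b2 p" for s t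
    proof -
      have "(\<Sum>b\<in>B. (if b = b1 then s else if b = b2 then t else 0) * b p)
          = (\<Sum>b\<in>B. (if b = b1 then s * b p else 0) + (if b = b2 then t * b p else 0))"
        using b by (intro sum.cong) auto
      then show ?thesis using b B by (simp add: sum.distrib)
    qed
    have "b2 p = 0"
      using zero[of "\<lambda>b. if b = b1 then b2 p else if b = b2 then - b1 p else 0"] b comb[of "b2 p" "- b1 p"]
      by auto
    then show False
      using zero[of "\<lambda>b. if b = b1 then 0 else if b = b2 then 1 else 0"] b comb[of 0 1] by auto
  qed
  then have "solution_multiplicity g p \<le> 1"
    unfolding solution_multiplicity_def by (intro SUP_least) (simp add: one_enat_def)
  moreover have "{\<lambda>x. 1} \<in> ?indep"
    by (auto simp: ideal local_ring_const)
  then have "enat (card {\<lambda>x::complex^'a. 1 :: complex}) \<le> solution_multiplicity g p"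
    unfolding solution_multiplicity_def by (rule SUP_upper)
  ultimately show ?thesis by (simp add: one_enat_def)
qed

text \<open>
  The difference \<open>1 / f\<^sub>i(x) - 1 / f\<^sub>i(p) = - a\<^sub>i \<cdot> (x - p) / (f\<^sub>i(x) f\<^sub>i(p))\<close> is an exact identity, so the
  critical equations are linear in \<open>x - p\<close> with coefficients in the local ring. At \<open>x = p\<close>, where the
  \<open>f\<^sub>i\<close> take real values, the coefficient matrix is negative definite.
\<close>

lemma critical_point_multiplicity:
  fixes a :: "real^'d^'n"
  assumes inj: "inj ((*v) a)" and u: "data_vector u" and p: "p \<in> critical_points a c u"
  shows "solution_multiplicity (critical_eq a c u) p = 1"
proof (rule solution_multiplicity_eq_1, rule local_ideal_eq_vanishing)
  let ?f = "lin_poly a c :: 'n \<Rightarrow> complex^'d \<Rightarrow> complex"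
  define N where "N j k x = - (\<Sum>i\<in>UNIV. of_nat (u $ i) * of_real (a $ i $ j) * of_real (a $ i $ k)
      / (?f i x * ?f i p))" for j k x
  have nz: "?f i p \<noteq> 0" for i using p by (simp add: critical_points_def)
  have psum: "complex_polynomial_function (\<lambda>x. \<Sum>i\<in>A. h i x)"
    if "\<And>i. complex_polynomial_function (h i)" for A and h :: "'d \<Rightarrow> complex^'d \<Rightarrow> complex"
    using that by (induction A rule: infinite_finite_induct) (auto intro: complex_polynomial_function.intros)
  have fpoly: "complex_polynomial_function (?f i)" for i
    unfolding lin_poly_def[abs_def] by (intro psum complex_polynomial_function.intros)
  show "N j k \<in> local_ring p" for j k
  proof -
    have "(\<lambda>x. \<Sum>i\<in>UNIV. - (of_nat (u $ i) * of_real (a $ i $ j) * of_real (a $ i $ k)) / (?f i x * ?f i p)) \<in> local_ring p"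
      by (intro local_ring_sum local_ring_divide local_ring_mult local_ring_const
          polynomial_in_local_ring fpoly) (simp add: nz)
    then show ?thesis by (simp add: N_def[abs_def] sum_negf)
  qed
  have "\<forall>\<^sub>F x in nhds p. \<forall>i\<in>UNIV. ?f i x \<noteq> 0"
    by (intro eventually_ball_finite ballI eventually_nonzero fpoly nz) simp
  then show "\<forall>\<^sub>F x in nhds p. \<forall>j. critical_eq a c u j x = (\<Sum>k\<in>UNIV. N j k x * (x $ k - p $ k))"
  proof eventually_elim
    fix x assume fx: "\<forall>i\<in>UNIV. ?f i x \<noteq> 0"
    show "\<forall>j. critical_eq a c u j x = (\<Sum>k\<in>UNIV. N j k x * (x $ k - p $ k))"
    proof
      fix j
      let ?A = "\<lambda>i. of_nat (u $ i) * complex_of_real (a $ i $ j)"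
      have diff: "?f i x - ?f i p = (\<Sum>k\<in>UNIV. of_real (a $ i $ k) * (x $ k - p $ k))" for i
        using lin_poly_add[of a c i p "x - p"] by simp
      have "critical_eq a c u j x = critical_eq a c u j x - critical_eq a c u j p"
        using p by (simp add: critical_points_def)
      also have "\<dots> = (\<Sum>i\<in>UNIV. - (?A i / (?f i x * ?f i p)) * (?f i x - ?f i p))"
        unfolding critical_eq_def sum_subtractf[symmetric]
        using fx nz by (intro sum.cong) (simp_all add: field_simps)
      also have "\<dots> = (\<Sum>i\<in>UNIV. \<Sum>k\<in>UNIV. - (?A i * of_real (a $ i $ k) / (?f i x * ?f i p)) * (x $ k - p $ k))"
        unfolding diff by (simp add: sum_distrib_left mult.assoc)
      also have "\<dots> = (\<Sum>k\<in>UNIV. N j k x * (x $ k - p $ k))"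
        by (subst sum.swap) (simp add: N_def sum_distrib_right sum_negf)
      finally show "critical_eq a c u j x = (\<Sum>k\<in>UNIV. N j k x * (x $ k - p $ k))" .
    qed
  qed
  have "w = 0" if w: "(\<chi> j k. N j k p) *v w = 0" for w
  proof -
    (* The Hermitian form of the matrix at w is minus the sum of u i / (r i)^2 * |l i|^2. *)
    define r where "r i = lin_poly a c i (vec_Re p)" for i
    have f: "?f i p = of_real (r i)" for i
      using critical_point_Im[OF p u] by (simp add: r_def lin_poly_complex complex_eq_iff)
    have r: "r i \<noteq> 0" for i using nz[of i] by (simp add: f)
    define l where "l i = (\<Sum>k\<in>UNIV. complex_of_real (a $ i $ k) * w $ k)" for i
    have cl: "cnj (l i) = (\<Sum>j\<in>UNIV. of_real (a $ i $ j) * cnj (w $ j))" for i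
      by (simp add: l_def)
    define B where "B i = complex_of_real (real (u $ i) / (r i)\<^sup>2)" for i
    have Nw: "((\<chi> j k. N j k p) *v w) $ j = - (\<Sum>i\<in>UNIV. B i * of_real (a $ i $ j) * l i)" for j
    proof -
      have "((\<chi> j k. N j k p) *v w) $ j
          = - (\<Sum>k\<in>UNIV. \<Sum>i\<in>UNIV. B i * of_real (a $ i $ j) * (of_real (a $ i $ k) * w $ k))"
        by (simp add: matrix_vector_mult_def N_def f B_def sum_distrib_right sum_negf power2_eq_square mult.assoc)
      then show ?thesis
        by (subst (asm) sum.swap) (simp add: l_def sum_distrib_left)
    qed
    have "0 = - (\<Sum>j\<in>UNIV. cnj (w $ j) * ((\<chi> j k. N j k p) *v w) $ j)"
      using w by simp
    also have "\<dots> = (\<Sum>j\<in>UNIV. \<Sum>i\<in>UNIV. B i * l i * (of_real (a $ i $ j) * cnj (w $ j)))"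
      unfolding Nw by (simp add: sum_distrib_left sum_negf mult_ac)
    also have "\<dots> = (\<Sum>i\<in>UNIV. B i * (cnj (l i) * l i))"
      by (subst sum.swap) (simp add: cl sum_distrib_left sum_distrib_right mult_ac)
    also have "\<dots> = of_real (\<Sum>i\<in>UNIV. real (u $ i) / (r i)\<^sup>2 * (cmod (l i))\<^sup>2)"
      by (simp add: B_def complex_norm_square mult.commute del: of_real_power)
    finally have "(\<Sum>i\<in>UNIV. real (u $ i) / (r i)\<^sup>2 * (cmod (l i))\<^sup>2) = 0"
      by (subst (asm) eq_commute) (simp only: of_real_eq_0_iff)
    then have terms0: "\<forall>i\<in>UNIV. real (u $ i) / (r i)\<^sup>2 * (cmod (l i))\<^sup>2 = 0"
      by (subst (asm) sum_nonneg_eq_0_iff) auto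
    then have l0: "l i = 0" for i 
    proof -
      have "u $ i \<noteq> 0" using u by (simp add: data_vector_def)
      then show ?thesis using bspec[OF terms0 UNIV_I, of i] r[of i] by simp
    qed
    have "(a *v vec_Re w) $ i = Re (l i)" "(a *v vec_Im w) $ i = Im (l i)" for i
      by (simp_all add: l_def matrix_vector_mult_def vec_Re_def vec_Im_def)
    then have "a *v vec_Re w = a *v 0" "a *v vec_Im w = a *v 0"
      using l0 by (simp_all add: vec_eq_iff)
    then have "vec_Re w = 0" "vec_Im w = 0" using injD[OF inj] by blast+
    then show "w = 0" by (simp add: vec_eq_iff vec_Re_def vec_Im_def complex_eq_iff)
  qed
  then show "det (\<chi> j k. N j k p) \<noteq> 0"
    unfolding invertible_det_nz[symmetric] invertible_left_inverse matrix_left_invertible_ker by blast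
qed

section \<open>The count\<close>

theorem theorem13:
  fixes a :: "real^'d^'n" and c :: "real^'n"
  assumes "rank a = CARD('d) \<or> for_general_data (\<lambda>u. finite (critical_points a c u))"
  shows "finite (bounded_regions a c) \<and>
         has_ML_degree a c (card (bounded_regions a c)) \<and>
         (\<forall>u. data_vector u \<longrightarrow> (\<forall>\<theta>\<in>critical_points a c u. \<forall>j. \<theta> $ j \<in> \<real>))"
proof (cases "inj ((*v) a)")
  case inj: True
  have real: "\<theta> $ j \<in> \<real>" if "data_vector u" "\<theta> \<in> critical_points a c u" for u \<theta> j
  proof -
    have "a *v vec_Im \<theta> = a *v 0" using critical_point_Im[OF that(2,1)] by simp
    then have "vec_Im \<theta> = 0" by (rule injD[OF inj])
    then show ?thesis by (simp add: vec_Im_def vec_eq_iff complex_is_Real_iff)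
  qed
  have "finite (critical_points a c u) \<and>
      (\<Sum>p\<in>critical_points a c u. solution_multiplicity (critical_eq a c u) p) =
        enat (card (bounded_regions a c))" if u: "data_vector u" for u
  proof -
    note bij = critical_points_bij_bounded_regions[OF inj u, of c]
    have "finite (critical_points a c u)" using bij_betw_finite[OF bij] finite_bounded_regions by blast
    moreover have "(\<Sum>p\<in>critical_points a c u. solution_multiplicity (critical_eq a c u) p) =
        enat (card (critical_points a c u))"
      by (simp add: critical_point_multiplicity[OF inj u] of_nat_eq_enat)
    ultimately show ?thesis using bij_betw_same_card[OF bij] by simp
  qed
  then have "has_ML_degree a c (card (bounded_regions a c))"
    unfolding has_ML_degree_def for_general_data_def
    by (intro exI[of _ "\<lambda>_. 1"]) auto
  with real show ?thesis using finite_bounded_regions by blast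
next
  case False
  then have "for_general_data (\<lambda>u. finite (critical_points a c u))"
    using assms by (simp add: full_rank_injective)
  then obtain u0 where u0: "data_vector u0" "finite (critical_points a c u0)"
    by (rule general_data_exists)
  obtain v where v: "a *v v = 0" "v \<noteq> 0"
    using False by (metis matrix_left_invertible_injective matrix_left_invertible_ker)
  have empty: "critical_points a c u = {}" if "data_vector u" for u
    using critical_points_all_data[OF that _ u0(1)] infinite_critical_points[OF _ v] u0(2) by blast
  have "bounded_regions a c = {}"
    using unbounded_chamber[OF v] by (auto simp: bounded_regions_eq)
  moreover have "has_ML_degree a c 0"
    unfolding has_ML_degree_def for_general_data_def
    by (intro exI[of _ "\<lambda>_. 1"]) (auto simp: empty zero_enat_def)
  ultimately show ?thesis using empty by simp
qed

end
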